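(* Let $d\ge 1$ and let $b_1,\dots,b_d\ge 2$ be fixed integers, and let $k$ be their multiplicative rank. Let $\mathcal{A}\subseteq\mathbb{N}$ be an infinite set, and let $\eta$ be a positive real-valued function defined for all sufficiently large real $x$. Put $$\mathcal{A}(x)=\#\{a\in\mathcal{A}: a\le x\},\qquad \mathcal{A}(x,h)=\#\{a\in\mathcal{A}: a\le x,\ a+h\in\mathcal{A}\}.$$ Suppose that, for all sufficiently large real $x$, $$\mathcal{A}(x)\asymp\frac{x}{\eta(x)},\qquad \mathcal{A}(x/2)\gg\mathcal{A}(x),$$ and $$\mathcal{A}(x,h)\ll\frac{h}{\varphi(h)}\,\frac{x}{\eta(x)^2}$$ uniformly in integers $h\ge 1$; that is, there are positive constants $C_1,C_2,C_3,C_4$ and a real $x_0$ such that for all real $x\ge x_0$ and all integers $h\ge1$ one has $C_1 x/\eta(x)\le \mathcal{A}(x)\le C_2 x/\eta(x)$, $\mathcal{A}(x/2)\ge C_3\mathcal{A}(x)$, and $\mathcal{A}(x,h)\le C_4\frac{h}{\varphi(h)}\frac{x}{\eta(x)^2}$. Then there exist positive constants $c_1,c_2$, depending only on $b_1,\dots,b_d$ and on the constants $C_1,C_2,C_3,C_4$ in these hypotheses, such that $$\#\left\{n\le x:\ R_{\mathcal{A}}(n)\ge c_1\frac{(\log x)^d}{\eta(x)}\right\}\ \ge\ c_2\,x\,\frac{(\log x)^k}{(\log x)^k+\eta(x)}$$ for all sufficiently large $x$.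
   Context: $\mathbb{N}=\{1,2,\dots\}$; $\log$ is the natural logarithm; $\varphi$ is Euler's totient function; $n$ runs over positive integers. For $\boldsymbol{u}=(u_1,\dots,u_d)\in\mathbb{N}^d$ put $\beta(\boldsymbol{u})=b_1^{u_1}\cdots b_d^{u_d}$. For $\mathcal{A}\subseteq\mathbb{N}$ and a positive integer $n$, $$R_{\mathcal{A}}(n)=\#\{(a,\boldsymbol{u})\in\mathcal{A}\times\mathbb{N}^d:\ a+\beta(\boldsymbol{u})=n\},$$ so that distinct exponent tuples are counted separately even when they give the same product. Positive integers $a_1,\dots,a_m$ are multiplicatively independent if $a_1^{t_1}\cdots a_m^{t_m}=1$ with $t_1,\dots,t_m\in\mathbb{Z}$ implies $t_1=\cdots=t_m=0$. The multiplicative rank $k$ of $b_1,\dots,b_d$ is the maximum number of multiplicatively independent elements among $b_1,\dots,b_d$; thus $1\le k\le d$. The notation $X\ll Y$ (equivalently $Y\gg X$) means $|X|\le CY$ for some constant $C>0$, and $X\asymp Y$ means $X\ll Y\ll X$. *)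

theory Defs
  imports Complex_Main "HOL-Number_Theory.Totient" "HOL-Library.FuncSet"
begin

(* Tuples of length d are extensional functions on {1..d}, so that distinct functions
   are distinct tuples. *)

definition exponent_tuples :: "nat \<Rightarrow> (nat \<Rightarrow> nat) set" where
  "exponent_tuples d = {1..d} \<rightarrow>\<^sub>E {1..}"

definition beta :: "nat \<Rightarrow> (nat \<Rightarrow> nat) \<Rightarrow> (nat \<Rightarrow> nat) \<Rightarrow> nat" where
  "beta d b u = (\<Prod>i\<in>{1..d}. b i ^ u i)"

(* The set below is finite when every b i is at least 2, so card is the true count there. *)
definition rep_count :: "nat \<Rightarrow> (nat \<Rightarrow> nat) \<Rightarrow> nat set \<Rightarrow> nat \<Rightarrow> nat" where
  "rep_count d b A n = card {(a, u) \<in> A \<times> exponent_tuples d. a + beta d b u = n}"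

(* Independence of the indexed family (a i), i in I: equal entries at different indices
   are dependent. *)
definition mult_indep :: "'i set \<Rightarrow> ('i \<Rightarrow> nat) \<Rightarrow> bool" where
  "mult_indep I a \<longleftrightarrow>
     (\<forall>t :: 'i \<Rightarrow> int. (\<Prod>i\<in>I. real (a i) powi t i) = 1 \<longrightarrow> (\<forall>i\<in>I. t i = 0))"

definition mult_rank :: "nat \<Rightarrow> (nat \<Rightarrow> nat) \<Rightarrow> nat" where
  "mult_rank d b = Max (card ` {I. I \<subseteq> {1..d} \<and> mult_indep I b})"

definition count_upto :: "nat set \<Rightarrow> real \<Rightarrow> nat" where
  "count_upto A x = card {a \<in> A. real a \<le> x}"

definition pair_count :: "nat set \<Rightarrow> real \<Rightarrow> nat \<Rightarrow> nat" where
  "pair_count A x h = card {a \<in> A. real a \<le> x \<and> a + h \<in> A}"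

(* Only the values of eta on {x0..} are constrained: a total function stands for one
   defined for all sufficiently large reals. *)
definition density_hyps ::
  "real \<Rightarrow> real \<Rightarrow> real \<Rightarrow> real \<Rightarrow> nat set \<Rightarrow> (real \<Rightarrow> real) \<Rightarrow> real \<Rightarrow> bool" where
  "density_hyps C1 C2 C3 C4 A eta x0 \<longleftrightarrow>
     (\<forall>x\<ge>x0.
        eta x > 0 \<and>
        C1 * x / eta x \<le> real (count_upto A x) \<and>
        real (count_upto A x) \<le> C2 * x / eta x \<and>
        real (count_upto A (x / 2)) \<ge> C3 * real (count_upto A x) \<and>
        (\<forall>h\<ge>1. real (pair_count A x h)
                 \<le> C4 * (real h / real (totient h)) * (x / (eta x)\<^sup>2)))"

end

theory Submission
  imports Defs "HOL-Number_Theory.Pocklington" "HOL-Analysis.Summation_Tests" "HOL-Analysis.Convex"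
begin

text \<open>
  The proof is a second moment argument in the style of Romanoff and Erdos. Let $P$ be the
  product of the bases and $L$ about $\log x / \log P$, so that all products $\beta(u)$ with exponents
  in the box $\{1,\dots,L\}^d$ are at most $x/2$. Let $R(n)$ count the representations $n = a + \beta(u)$
  with $a \le x/2$ in the set and $u$ in the box. The first moment of $R$ is
  $\mathcal{A}(x/2) L^d \gg (x/\eta) L^d$, so on average over $n \le x$ it is of the order $L^d/\eta$,
  and by Cauchy--Schwarz (\<open>second_moment_lower_bound\<close>) the number of $n$ with $R(n)$ at least half
  of that is at least the squared first moment divided by four times the second moment.

  The second moment counts the solutions of $a + \beta(u) = a' + \beta(v)$
  (\<open>card_box_collisions_le\<close>). If $\beta(u) = \beta(v)$, then $a = a'$; the coordinates
  belonging to $k$ multiplicatively independent bases are determined by the other $d - k$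
  (\<open>card_beta_eq_le\<close>), so this case has $\ll (x/\eta) L^{2d-k}$ solutions. If
  $h = |\beta(u) - \beta(v)| > 0$, the hypothesis on pairs gives
  $\ll (h/\varphi(h)) x/\eta^2$ solutions, and everything rests on the fact that $h/\varphi(h)$ is bounded
  on average over $u$ and $v$ (\<open>sum_totient_quotient_gap_le\<close>). Then the second moment is
  $\ll (x L^{2d}/\eta^2)(1 + \eta/L^k)$, and dividing gives the density $L^k/(L^k + \eta)$.

  For the average of $h/\varphi(h)$, note that $h$ has $O(L)$ prime factors, so those above $L$
  contribute a bounded factor. Adding the remaining primes one at a time, and bounding the
  product over all smaller primes by $O(p^{1/3})$, yields
  $h/\varphi(h) \ll 1 + \sum p^{-2/3}$ over the primes $p \le L$ dividing $h$
  (\<open>totient_quotient_bound\<close>). Let $e$ be the order of the first base modulo $p$. If $p$ divides no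
  base, the proportion of pairs whose difference is divisible by $p$ is at most
  $1/L + 1/e \le 2/e$, because $e < p \le L$ (\<open>card_beta_cong_le\<close>). The sum of $p^{-2/3}/e$ over
  these primes converges, since few primes have a small order (\<open>sum_over_orders_bounded\<close>).
\<close>

section \<open>The quotient $h/\varphi(h)$ in terms of small primes\<close>

text \<open>Above 3 every prime is $\pm 1$ modulo 6, so each block of six integers contributes at
  most two factors. Both are about $1 + 1/(6k)$, so the cube of the product grows like $k$; the
  shift in $2k - 1$ gives the second order slack that makes the inequality for one block true.\<close>

lemma prime_product_below_multiple_of_6:
  fixes k :: nat
  assumes "k \<ge> 1"
  shows "(\<Prod>q | prime q \<and> q < 6 * k. real q / (real q - 1)) ^ 3 \<le> 53 * (2 * real k - 1)"
  using assms
proof (induction k rule: nat_induct_at_least)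
  case base
  have "{q :: nat. prime q \<and> q < 6} = {2, 3, 5}"
  proof -
    have "prime q \<longleftrightarrow> q = 2 \<or> q = 3 \<or> q = 5" if "q < 6" for q :: nat
    proof -
      have "q = 0 \<or> q = 1 \<or> q = 2 \<or> q = 3 \<or> q = 4 \<or> q = 5"
        using that by linarith
      then show ?thesis by (elim disjE) simp_all
    qed
    then show ?thesis by auto
  qed
  then show ?case by (simp add: power3_eq_cube)
next
  case (Suc k)
  let ?f = "\<lambda>q. real q / (real q - 1)"
  let ?S = "{q. prime q \<and> q < 6 * k}"
  have new: "q = 6 * k + 1 \<or> q = 6 * k + 5" if "prime q" "q < 6 * Suc k" "\<not> q < 6 * k" for q
  proof -
    have "q > 3" using Suc.hyps that by linarith
    then have "q mod 2 \<noteq> 0" "q mod 3 \<noteq> 0"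
      using \<open>prime q\<close> by (auto simp: prime_nat_iff simp flip: dvd_eq_mod_eq_0)
    then show ?thesis
      using that(2,3) by presburger
  qed
  have fin: "finite ?S" by (rule finite_subset[of _ "{..<6 * k}"]) auto
  have pos: "(\<Prod>q\<in>?S. ?f q) \<ge> 0"
    by (intro prod_nonneg) (auto dest: prime_ge_1_nat)
  have "(\<Prod>q | prime q \<and> q < 6 * Suc k. ?f q) \<le> (\<Prod>q \<in> ?S \<union> {6 * k + 1, 6 * k + 5}. ?f q)"
  proof (rule prod_mono2)
    show "{q. prime q \<and> q < 6 * Suc k} \<subseteq> ?S \<union> {6 * k + 1, 6 * k + 5}"
      using new by blast
  qed (use fin Suc.hyps in \<open>auto dest: prime_ge_1_nat simp: field_simps\<close>)
  also have "\<dots> = (\<Prod>q\<in>?S. ?f q) * (?f (6 * k + 1) * ?f (6 * k + 5))"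
    by (subst prod.union_disjoint) (use fin in auto)
  finally have "(\<Prod>q | prime q \<and> q < 6 * Suc k. ?f q) ^ 3
      \<le> ((\<Prod>q\<in>?S. ?f q) * (?f (6 * k + 1) * ?f (6 * k + 5))) ^ 3"
    by (rule power_mono) (intro prod_nonneg, auto dest: prime_ge_1_nat)
  also have "\<dots> = (\<Prod>q\<in>?S. ?f q) ^ 3 * (?f (6 * k + 1) * ?f (6 * k + 5)) ^ 3"
    by (rule power_mult_distrib)
  also have "\<dots> \<le> (53 * (2 * real k - 1)) * ((2 * real k + 1) / (2 * real k - 1))"
  proof (rule mult_mono)
    show "(?f (6 * k + 1) * ?f (6 * k + 5)) ^ 3 \<le> (2 * real k + 1) / (2 * real k - 1)"
    proof -
      \<comment> \<open>In terms of \<open>y\<close> the difference of the two sides has nonnegative coefficients.\<close>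
      define y where "y = real k - 1"
      have y: "y \<ge> 0" "real k = y + 1" using Suc.hyps by (auto simp: y_def)
      define v w where "v = (6 * y + 7) * (6 * y + 11)" and "w = (6 * y + 6) * (6 * y + 10)"
      have "(2 * y + 3) * w ^ 3 = v ^ 3 * (2 * y + 1) + (191467 + 708338 * y
          + 1039932 * y ^ 2 + 756648 * y ^ 3 + 272592 * y ^ 4 + 38880 * y ^ 5)"
        by (simp add: v_def w_def field_simps power_numeral_reduce)
      then have "v ^ 3 * (2 * y + 1) \<le> (2 * y + 3) * w ^ 3" using y(1) by simp
      then have "(v / w) ^ 3 \<le> (2 * y + 3) / (2 * y + 1)"
        using y(1) by (simp add: power_divide divide_simps w_def)
      moreover have "?f (6 * k + 1) * ?f (6 * k + 5) = v / w"
        by (simp add: y(2) v_def w_def algebra_simps)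
      ultimately show ?thesis using y(2) by (simp add: algebra_simps)
    qed
  qed (use Suc pos in auto)
  also have "\<dots> = 53 * (2 * real (Suc k) - 1)"
    using Suc.hyps by (simp add: field_simps)
  finally show ?case .
qed

text \<open>Any exponent below $1/2$ would serve for the summation over orders below, so the sharp
  logarithmic bound of Mertens can be avoided; residue classes modulo 2 alone would give
  exactly $1/2$.\<close>

lemma prime_product_below:
  fixes n :: nat
  assumes "n \<ge> 1"
  shows "(\<Prod>q | prime q \<and> q < n. real q / (real q - 1)) \<le> 5 * real n powr (1/3)"
proof -
  let ?f = "\<lambda>q. real q / (real q - 1)"
  define k where "k = n div 6 + 1"
  have k: "n < 6 * k" "6 * k \<le> n + 6" by (auto simp: k_def)
  have "(\<Prod>q | prime q \<and> q < n. ?f q) \<le> (\<Prod>q | prime q \<and> q < 6 * k. ?f q)"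
    using k(1) by (intro prod_mono2) (auto dest: prime_ge_1_nat prime_gt_1_nat)
  then have "(\<Prod>q | prime q \<and> q < n. ?f q) ^ 3 \<le> (\<Prod>q | prime q \<and> q < 6 * k. ?f q) ^ 3"
    by (rule power_mono) (intro prod_nonneg, auto dest: prime_ge_1_nat)
  also have "\<dots> \<le> 53 * (2 * real k - 1)"
    by (rule prime_product_below_multiple_of_6) (simp add: k_def)
  also have "\<dots> \<le> (5 * real n powr (1/3)) ^ 3"
  proof -
    have "(real n powr (1/3)) ^ 3 = real n"
      using assms by (simp add: powr_realpow[symmetric] powr_powr)
    then have "(5 * real n powr (1/3)) ^ 3 = 125 * real n"
      by (simp add: power_mult_distrib)
    moreover have "6 * real k \<le> real n + 6" using k(2) by linarith
    ultimately show ?thesis using assms by simp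
  qed
  finally have "(\<Prod>q | prime q \<and> q < n. ?f q) ^ 3 \<le> (5 * real n powr (1/3)) ^ 3" .
  moreover have "(\<Prod>q | prime q \<and> q < n. ?f q) \<ge> 0"
    by (intro prod_nonneg) (auto dest: prime_ge_1_nat)
  ultimately show ?thesis
    by (subst (asm) power_mono_iff) auto
qed

text \<open>The factor $p/(p-1)$ is $1 + 1/(p-1)$: adding the primes in increasing order raises the
  product by $1/(p-1)$ times the product over the smaller primes.\<close>

lemma euler_product_telescope:
  fixes S :: "nat set"
  assumes "finite S" and "\<And>p. p \<in> S \<Longrightarrow> p \<ge> 2"
  shows "(\<Prod>p\<in>S. real p / (real p - 1))
       = 1 + (\<Sum>p\<in>S. 1 / (real p - 1) * (\<Prod>q | q \<in> S \<and> q < p. real q / (real q - 1)))"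
  using assms
proof (induction S rule: finite_linorder_max_induct)
  case (insert m S)
  let ?f = "\<lambda>q. real q / (real q - 1)"
  have "(\<Prod>q | q \<in> insert m S \<and> q < p. ?f q) = (\<Prod>q | q \<in> S \<and> q < p. ?f q)" if "p \<in> S" for p
    using insert.hyps that by (intro prod.cong) auto
  then have "(\<Sum>p\<in>S. 1 / (real p - 1) * (\<Prod>q | q \<in> insert m S \<and> q < p. ?f q))
      = (\<Prod>p\<in>S. ?f p) - 1"
    using insert.IH insert.prems by simp
  moreover have "{q. q \<in> insert m S \<and> q < m} = S"
    using insert.hyps by auto
  moreover have "m \<notin> S" using insert.hyps by auto
  moreover have "?f m = 1 + 1 / (real m - 1)"
    using insert.prems[of m] by (simp add: field_simps)
  ultimately show ?case
    using insert.hyps by (simp add: algebra_simps)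
qed simp

text \<open>Replacing the product over the smaller primes of \<open>S\<close> by the one over all smaller primes
  decouples the primes of \<open>S\<close> from each other. A multiplicative function is thereby controlled by an
  additive one, so that averaging it only requires the frequency of divisibility by a single prime.\<close>

lemma euler_product_le_sum:
  fixes S :: "nat set"
  assumes "finite S" and prime: "\<And>p. p \<in> S \<Longrightarrow> prime p"
  shows "(\<Prod>p\<in>S. real p / (real p - 1)) \<le> 1 + 10 * (\<Sum>p\<in>S. real p powr (-2/3))"
proof -
  let ?f = "\<lambda>q. real q / (real q - 1)"
  have ge2: "p \<ge> 2" if "p \<in> S" for p
    using prime[OF that] by (rule prime_ge_2_nat)
  have "1 / (real p - 1) * (\<Prod>q | q \<in> S \<and> q < p. ?f q) \<le> 10 * real p powr (-2/3)"
    if "p \<in> S" for p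
  proof -
    have p: "p \<ge> 2" using ge2 that by blast
    have nonneg: "?f q \<ge> 0" if "q \<in> S" for q using ge2[OF that] by simp
    have "(\<Prod>q | q \<in> S \<and> q < p. ?f q) \<le> (\<Prod>q | prime q \<and> q < p. ?f q)"
      by (intro prod_mono2) (use prime nonneg in \<open>auto dest: prime_gt_1_nat\<close>)
    also have "\<dots> \<le> 5 * real p powr (1/3)"
      using p by (intro prime_product_below) auto
    finally have prod_le: "(\<Prod>q | q \<in> S \<and> q < p. ?f q) \<le> 5 * real p powr (1/3)" .
    have prod_nonneg: "0 \<le> (\<Prod>q | q \<in> S \<and> q < p. ?f q)"
      by (intro prod_nonneg) (use nonneg in blast)
    have "1 / (real p - 1) \<le> 2 / real p" using p by (simp add: field_simps)
    from mult_mono[OF this prod_le _ prod_nonneg]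
    have "1 / (real p - 1) * (\<Prod>q | q \<in> S \<and> q < p. ?f q)
        \<le> (2 / real p) * (5 * real p powr (1/3))"
      by simp
    also have "\<dots> = 10 * (real p powr (1/3) * real p powr (-1))"
      using p by (simp add: powr_minus field_simps)
    also have "real p powr (1/3) * real p powr (-1) = real p powr (-2/3)"
      by (simp only: powr_add[symmetric]) simp
    finally show ?thesis .
  qed
  then show ?thesis
    using assms ge2 by (subst euler_product_telescope) (auto simp: sum_distrib_left intro!: sum_mono)
qed

lemma two_power_card_prime_factors_le:
  assumes "n \<ge> (1::nat)"
  shows "2 ^ card (prime_factors n) \<le> n"
proof -
  have "2 ^ card (prime_factors n) = (\<Prod>p\<in>prime_factors n. 2 :: nat)" by simp
  also have "\<dots> \<le> (\<Prod>p\<in>prime_factors n. p)"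
    by (intro prod_mono) (auto intro: prime_ge_2_nat in_prime_factors_imp_prime)
  also have "\<dots> \<le> (\<Prod>p\<in>prime_factors n. p ^ multiplicity p n)"
    by (intro prod_mono)
       (auto intro!: self_le_power simp: prime_factors_multiplicity dest: prime_ge_1_nat)
  also have "\<dots> = n" using assms by (simp add: prime_factorization_nat[symmetric])
  finally show ?thesis .
qed

text \<open>An integer up to $2^M$ has at most $M$ prime factors, and those exceeding $L$ contribute
  a factor of at most $1 + 1/L$ each, hence a bounded factor as long as $M$ is of the order of $L$. Only the
  primes up to $L$ remain.\<close>

lemma totient_quotient_bound:
  fixes h L M :: nat
  assumes "h \<ge> 1" and "L \<ge> 1" and "h \<le> 2 ^ M"
  shows "real h / real (totient h)
       \<le> exp (real M / real L) * (1 + 10 * (\<Sum>p | prime p \<and> p \<le> L \<and> p dvd h. real p powr (-2/3)))"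
proof -
  let ?f = "\<lambda>p. real p / (real p - 1)"
  define S where "S = {p. prime p \<and> p \<le> L \<and> p dvd h}"
  define B where "B = prime_factors h - S"
  have S: "S \<subseteq> prime_factors h" using assms by (auto simp: S_def prime_factors_dvd)
  have ge2: "p \<ge> 2" if "p \<in> prime_factors h" for p
    using that by (auto intro: prime_ge_2_nat in_prime_factors_imp_prime)
  have "real h / real (totient h) = 1 / (\<Prod>p\<in>prime_factors h. 1 - 1 / real p)"
    using assms by (subst totient_formula2) simp
  also have "\<dots> = (\<Prod>p\<in>prime_factors h. ?f p)"
    unfolding prod_dividef[symmetric, of "\<lambda>_. 1", simplified]
    by (intro prod.cong) (use ge2 in \<open>force simp: field_simps\<close>)+
  also have "\<dots> = (\<Prod>p\<in>B. ?f p) * (\<Prod>p\<in>S. ?f p)"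
    unfolding B_def using S by (subst prod.subset_diff) auto
  also have "\<dots> \<le> exp (real M / real L) * (1 + 10 * (\<Sum>p\<in>S. real p powr (-2/3)))"
  proof (rule mult_mono)
    have "?f p \<le> exp (1 / real L)" if "p \<in> B" for p
    proof -
      have "p > L" using that by (auto simp: B_def S_def prime_factors_dvd)
      then have "?f p \<le> 1 + 1 / real L" using \<open>L \<ge> 1\<close> by (simp add: field_simps)
      then show ?thesis using exp_ge_add_one_self[of "1 / real L"] by linarith
    qed
    then have "(\<Prod>p\<in>B. ?f p) \<le> (\<Prod>p\<in>B. exp (1 / real L))"
      using ge2 by (intro prod_mono) (force simp: B_def)
    also have "\<dots> = exp (real (card B) / real L)"
      by (simp flip: exp_of_nat_mult)
    also have "\<dots> \<le> exp (real M / real L)"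
    proof -
      have "card B \<le> card (prime_factors h)" unfolding B_def by (intro card_mono) auto
      moreover have "(2::nat) ^ card (prime_factors h) \<le> 2 ^ M"
        using two_power_card_prime_factors_le[OF \<open>h \<ge> 1\<close>] assms by linarith
      ultimately show ?thesis by (simp add: divide_right_mono)
    qed
    finally show "(\<Prod>p\<in>B. ?f p) \<le> exp (real M / real L)" .
    show "(\<Prod>p\<in>S. ?f p) \<le> 1 + 10 * (\<Sum>p\<in>S. real p powr (-2/3))"
      using S finite_subset[OF S] by (intro euler_product_le_sum) (auto simp: S_def)
    show "0 \<le> (\<Prod>p\<in>S. ?f p)"
      using S ge2 by (intro prod_nonneg) force
  qed auto
  finally show ?thesis unfolding S_def .
qed

section \<open>Orders modulo primes\<close>

text \<open>All these primes divide $b^n - 1$, which is less than $2^{bn}$.\<close>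

lemma card_primes_of_order_le:
  fixes b n :: nat and S :: "nat set"
  assumes "b \<ge> 2" and "n \<ge> 1" and S: "\<And>p. p \<in> S \<Longrightarrow> prime p \<and> ord p b = n"
  shows "card S \<le> b * n"
proof -
  have h: "b ^ n - 1 \<ge> 1"
    using assms power_increasing[of 1 n b] by simp
  have "S \<subseteq> prime_factors (b ^ n - 1)"
  proof
    fix p assume "p \<in> S"
    then have "[b ^ n = 1] (mod p)" and "prime p" using S ord[of b p] by auto
    then have "p dvd b ^ n - 1"
      by (intro cong_to_1_nat)
    then show "p \<in> prime_factors (b ^ n - 1)"
      using \<open>prime p\<close> h by (simp add: prime_factors_dvd)
  qed
  then have "card S \<le> card (prime_factors (b ^ n - 1))" by (intro card_mono) auto
  moreover have "(2::nat) ^ card (prime_factors (b ^ n - 1)) \<le> 2 ^ (b * n)"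
  proof -
    have "b ^ n \<le> (2 ^ b) ^ n" by (intro power_mono) (auto simp: less_imp_le less_exp)
    then show ?thesis using two_power_card_prime_factors_le[OF h] by (simp add: power_mult)
  qed
  ultimately show ?thesis by simp
qed

text \<open>Romanoff's convergence lemma with weight $p^{-2/3}$. Primes whose order $e$ is at least
  $p^{2/5}$ contribute at most $p^{-16/15}$; for the others $p > e^{5/2}$, and they contribute at
  most $e^{-8/3}$ each, where at most $bn$ primes have order $n$.\<close>

lemma sum_over_orders_bounded:
  fixes b :: nat
  assumes "b \<ge> 2"
  shows "\<exists>C\<ge>0. \<forall>S. finite S \<and> (\<forall>p\<in>S. prime p \<and> coprime p b) \<longrightarrow>
           (\<Sum>p\<in>S. real p powr (-2/3) / real (ord p b)) \<le> C"
proof (intro exI conjI allI impI)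
  let ?Z = "\<lambda>s. \<Sum>n. real n powr s"
  show "0 \<le> ?Z (-16/15) + real b * ?Z (-5/3)"
    by (intro add_nonneg_nonneg mult_nonneg_nonneg suminf_nonneg) (simp_all add: summable_real_powr_iff)
  fix S :: "nat set"
  assume "finite S \<and> (\<forall>p\<in>S. prime p \<and> coprime p b)"
  then have fin: "finite S" and S: "\<And>p. p \<in> S \<Longrightarrow> prime p \<and> coprime p b" by auto
  have "real p powr (-2/3) / real (ord p b)
      \<le> real p powr (-16/15) + real (ord p b) powr (-8/3)" if "p \<in> S" for p
  proof -
    define e where "e = real (ord p b)"
    have p: "real p > 0" using S[OF that] prime_gt_0_nat by auto
    have e: "e \<ge> 1" using S[OF that] by (simp add: e_def Suc_le_eq)
    show ?thesis
    proof (cases "e \<ge> real p powr (2/5)")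
      case True
      then have "real p powr (-2/3) / e \<le> real p powr (-2/3) / real p powr (2/5)"
        using p e by (intro divide_left_mono) auto
      also have "\<dots> = real p powr (-16/15)" by (simp add: powr_diff[symmetric])
      finally show ?thesis by (simp add: e_def add_increasing2)
    next
      case False
      then have "e powr (5/2) \<le> (real p powr (2/5)) powr (5/2)"
        using e by (intro powr_mono2) auto
      then have "e powr (5/2) \<le> real p" using p by (simp add: powr_powr)
      then have "real p powr (-2/3) \<le> (e powr (5/2)) powr (-2/3)"
        using e by (intro powr_mono2') auto
      then have "real p powr (-2/3) / e \<le> e powr (-5/3) / e"
        using e by (intro divide_right_mono) (auto simp: powr_powr)
      also have "\<dots> = e powr (-8/3)"
        using e powr_diff[of e "-5/3" 1] by simp
      finally show ?thesis by (simp add: e_def add_increasing)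
    qed
  qed
  then have "(\<Sum>p\<in>S. real p powr (-2/3) / real (ord p b))
      \<le> (\<Sum>p\<in>S. real p powr (-16/15)) + (\<Sum>p\<in>S. real (ord p b) powr (-8/3))"
    unfolding sum.distrib[symmetric] by (rule sum_mono)
  also have "\<dots> \<le> ?Z (-16/15) + real b * ?Z (-5/3)"
  proof (rule add_mono)
    show "(\<Sum>p\<in>S. real p powr (-16/15)) \<le> ?Z (-16/15)"
      using fin by (intro sum_le_suminf) (auto simp: summable_real_powr_iff)
    define R where "R = (\<lambda>p. ord p b) ` S"
    have "(\<Sum>p\<in>S. real (ord p b) powr (-8/3))
        = (\<Sum>n\<in>R. real (card {p \<in> S. ord p b = n}) * real n powr (-8/3))"
      using fin by (intro sum_fun_comp) (auto simp: R_def)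
    also have "\<dots> \<le> (\<Sum>n\<in>R. real b * real n powr (-5/3))"
    proof (rule sum_mono)
      fix n assume "n \<in> R"
      then have n: "n \<ge> 1" using S by (auto simp: R_def Suc_le_eq)
      have "card {p \<in> S. ord p b = n} \<le> b * n"
        using S n assms by (intro card_primes_of_order_le) auto
      then have "real (card {p \<in> S. ord p b = n}) \<le> real b * real n"
        by (metis of_nat_le_iff of_nat_mult)
      then have "real (card {p \<in> S. ord p b = n}) * real n powr (-8/3)
          \<le> real b * real n * real n powr (-8/3)"
        by (rule mult_right_mono) simp
      also have "\<dots> = real b * (real n powr 1 * real n powr (-8/3))"
        by simp
      also have "\<dots> = real b * real n powr (-5/3)" by (simp only: powr_add[symmetric]) simp
      finally show "real (card {p \<in> S. ord p b = n}) * real n powr (-8/3) \<le> real b * real n powr (-5/3)" .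
    qed
    also have "\<dots> \<le> real b * ?Z (-5/3)"
      unfolding sum_distrib_left[symmetric] using fin
      by (intro mult_left_mono sum_le_suminf) (auto simp: summable_real_powr_iff R_def)
    finally show "(\<Sum>p\<in>S. real (ord p b) powr (-8/3)) \<le> real b * ?Z (-5/3)" .
  qed
  finally show "(\<Sum>p\<in>S. real p powr (-2/3) / real (ord p b)) \<le> ?Z (-16/15) + real b * ?Z (-5/3)" .
qed

section \<open>Products with exponents in a box\<close>

definition exponent_box :: "nat \<Rightarrow> nat \<Rightarrow> (nat \<Rightarrow> nat) set" where
  "exponent_box d L = {1..d} \<rightarrow>\<^sub>E {1..L}"

lemma finite_exponent_box [simp]: "finite (exponent_box d L)"
  unfolding exponent_box_def by (intro finite_PiE) auto

lemma card_exponent_box: "card (exponent_box d L) = L ^ d"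
  unfolding exponent_box_def by (simp add: card_PiE)

lemma exponent_box_subset_exponent_tuples: "exponent_box d L \<subseteq> exponent_tuples d"
  unfolding exponent_box_def exponent_tuples_def by (intro PiE_mono) auto

lemma beta_exponent_box_le:
  assumes "u \<in> exponent_box d L" and "\<And>i. i \<in> {1..d} \<Longrightarrow> b i \<ge> 1"
  shows "beta d b u \<le> (\<Prod>i\<in>{1..d}. b i) ^ L"
  unfolding beta_def prod_power_distrib
  using assms by (intro prod_mono) (auto simp: exponent_box_def PiE_iff intro!: power_increasing)

lemma exponent_box_ext:
  assumes "u \<in> exponent_box d L" and "w \<in> exponent_box d L"
    and "\<And>i. i \<in> {1..d} \<Longrightarrow> u i = w i"
  shows "u = w"
  using assms unfolding exponent_box_def by (rule PiE_ext)

text \<open>Both counts below bound a set of exponent tuples on which the coordinates outside some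
  \<open>I\<close> determine the rest.\<close>

lemma card_determined_off_le:
  assumes "I \<subseteq> {1..d}"
    and "T \<subseteq> exponent_box d L"
    and "\<And>u w. u \<in> T \<Longrightarrow> w \<in> T \<Longrightarrow> (\<And>i. i \<in> {1..d} - I \<Longrightarrow> u i = w i) \<Longrightarrow> u = w"
  shows "card T \<le> L ^ (d - card I)"
proof -
  let ?r = "\<lambda>u. restrict u ({1..d} - I)"
  have "inj_on ?r T"
  proof (rule inj_onI)
    fix u w assume "u \<in> T" "w \<in> T" "?r u = ?r w"
    then show "u = w"
      using assms(3)[of u w] fun_cong[of "?r u" "?r w"] by (metis restrict_apply')
  qed
  moreover have "?r ` T \<subseteq> ({1..d} - I) \<rightarrow>\<^sub>E {1..L}"
    using assms(2) by (fastforce simp: exponent_box_def PiE_iff)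
  ultimately have "card T \<le> card (({1..d} - I) \<rightarrow>\<^sub>E {1..L})"
    by (intro card_inj_on_le) (auto intro: finite_PiE)
  also have "\<dots> = L ^ (d - card I)"
    using assms(1) by (simp add: card_PiE card_Diff_subset finite_subset)
  finally show ?thesis .
qed

lemma beta_split:
  assumes "I \<subseteq> {1..d}"
  shows "beta d b u = (\<Prod>i\<in>I. b i ^ u i) * (\<Prod>i\<in>{1..d} - I. b i ^ u i)"
  unfolding beta_def using assms by (subst prod.subset_diff[of I]) (auto simp: mult.commute)

text \<open>The coordinates outside an independent set determine those inside. The rank
  enters here: for an independent set of maximal size the exponent is $d - k$.\<close>

lemma card_beta_eq_le:
  assumes b: "\<And>i. i \<in> {1..d} \<Longrightarrow> b i \<ge> 1"
    and "I \<subseteq> {1..d}" and "mult_indep I b"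
  shows "card {u \<in> exponent_box d L. beta d b u = m} \<le> L ^ (d - card I)"
proof (rule card_determined_off_le[OF \<open>I \<subseteq> {1..d}\<close>])
  fix u w
  assume uw: "u \<in> {u \<in> exponent_box d L. beta d b u = m}" "w \<in> {u \<in> exponent_box d L. beta d b u = m}"
    and same: "\<And>i. i \<in> {1..d} - I \<Longrightarrow> u i = w i"
  have pos: "b i > 0" if "i \<in> {1..d}" for i using b[OF that] by simp
  define R where "R = (\<Prod>i\<in>{1..d} - I. b i ^ u i)"
  have R: "R > 0" unfolding R_def using pos by (intro prod_pos) auto
  have "(\<Prod>i\<in>{1..d} - I. b i ^ w i) = R"
    unfolding R_def using same by (intro prod.cong) auto
  then have "(\<Prod>i\<in>I. b i ^ u i) * R = (\<Prod>i\<in>I. b i ^ w i) * R"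
    using uw beta_split[OF \<open>I \<subseteq> {1..d}\<close>, of b] by (simp add: R_def)
  then have eq: "(\<Prod>i\<in>I. b i ^ u i) = (\<Prod>i\<in>I. b i ^ w i)"
    using R by simp
  have "(\<Prod>i\<in>I. real (b i) powi (int (u i) - int (w i)))
      = (\<Prod>i\<in>I. real (b i ^ u i) / real (b i ^ w i))"
    using pos \<open>I \<subseteq> {1..d}\<close> by (intro prod.cong) (auto simp: power_int_diff)
  also have "\<dots> = real (\<Prod>i\<in>I. b i ^ u i) / real (\<Prod>i\<in>I. b i ^ w i)"
    by (simp add: prod_dividef)
  also have "\<dots> = 1"
    unfolding eq using pos \<open>I \<subseteq> {1..d}\<close> finite_subset[of I "{1..d}"] by (auto simp: subset_iff)
  finally have "\<forall>i\<in>I. int (u i) - int (w i) = 0"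
    using spec[OF \<open>mult_indep I b\<close>[unfolded mult_indep_def], of "\<lambda>i. int (u i) - int (w i)"] by simp
  then have eqI: "u i = w i" if "i \<in> I" for i using that by simp
  show "u = w"
  proof (rule exponent_box_ext)
    show "u \<in> exponent_box d L" "w \<in> exponent_box d L" using uw by simp_all
    show "u i = w i" if "i \<in> {1..d}" for i
      using eqI[of i] same[of i] that by blast
  qed
qed auto

text \<open>Once the other exponents are fixed, the congruence fixes \<open>u 1\<close> modulo the order of \<open>b 1\<close>.
  Sorting by the quotient \<open>u 1 div ord p (b 1)\<close> then makes \<open>u 1\<close> a function of the other
  coordinates.\<close>

lemma card_beta_cong_le:
  assumes "d \<ge> 1" and "prime p" and cop: "\<And>i. i \<in> {1..d} \<Longrightarrow> coprime p (b i)"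
  shows "card {u \<in> exponent_box d L. [beta d b u = m] (mod p)} \<le> L ^ (d - 1) * (L div ord p (b 1) + 1)"
proof -
  define T where "T = {u \<in> exponent_box d L. [beta d b u = m] (mod p)}"
  define e where "e = ord p (b 1)"
  have e: "e > 0" using cop[of 1] \<open>d \<ge> 1\<close> by (simp add: e_def)
  have class_le: "card {u \<in> T. u 1 div e = q} \<le> L ^ (d - 1)" for q
  proof -
    have "card {u \<in> T. u 1 div e = q} \<le> L ^ (d - card {1::nat})"
    proof (rule card_determined_off_le)
      fix u w
      assume uw: "u \<in> {u \<in> T. u 1 div e = q}" "w \<in> {u \<in> T. u 1 div e = q}"
        and same: "\<And>i. i \<in> {1..d} - {1} \<Longrightarrow> u i = w i"
      let ?R = "\<Prod>i\<in>{1..d} - {1}. b i ^ u i"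
      have R: "(\<Prod>i\<in>{1..d} - {1}. b i ^ w i) = ?R"
        using same by (intro prod.cong) auto
      have "[beta d b u = beta d b w] (mod p)"
        using uw by (auto simp: T_def intro: cong_trans cong_sym)
      then have "[b 1 ^ u 1 * ?R = b 1 ^ w 1 * ?R] (mod p)"
        using beta_split[of "{1}" d b] \<open>d \<ge> 1\<close> R by simp
      moreover have "coprime ?R p"
        using cop by (intro prod_coprime_left) (auto simp: coprime_commute)
      ultimately have "[b 1 ^ u 1 = b 1 ^ w 1] (mod p)"
        by (simp add: cong_mult_rcancel_nat)
      then have "[u 1 = w 1] (mod e)"
        using cop[of 1] \<open>d \<ge> 1\<close> order_divides_expdiff[of p "b 1" "u 1" "w 1"]
        by (simp add: e_def)
      then have rem: "u 1 mod e = w 1 mod e" by (simp add: cong_def)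
      have quot: "u 1 div e = w 1 div e" using uw by simp
      have "u 1 = u 1 div e * e + u 1 mod e" by simp
      also have "\<dots> = w 1 div e * e + w 1 mod e" by (simp only: rem quot)
      also have "\<dots> = w 1" by simp
      finally have "u 1 = w 1" .
      show "u = w"
      proof (rule exponent_box_ext)
        show "u \<in> exponent_box d L" "w \<in> exponent_box d L" using uw by (simp_all add: T_def)
        show "u i = w i" if "i \<in> {1..d}" for i
          using \<open>u 1 = w 1\<close> same[of i] that by blast
      qed
    qed (use \<open>d \<ge> 1\<close> in \<open>auto simp: T_def\<close>)
    then show ?thesis by simp
  qed
  have "u 1 div e \<le> L div e" if "u \<in> T" for u
  proof (rule div_le_mono)
    have "u 1 \<in> {1..L}" using that \<open>d \<ge> 1\<close> by (simp add: T_def exponent_box_def PiE_iff)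
    then show "u 1 \<le> L" by simp
  qed
  then have "T = (\<Union>q\<in>{0..L div e}. {u \<in> T. u 1 div e = q})" by auto
  then have "card T \<le> (\<Sum>q\<in>{0..L div e}. card {u \<in> T. u 1 div e = q})"
    using card_UN_le[of "{0..L div e}" "\<lambda>q. {u \<in> T. u 1 div e = q}"] by simp
  also have "\<dots> \<le> (\<Sum>q\<in>{0..L div e}. L ^ (d - 1))"
    by (intro sum_mono class_le)
  finally show ?thesis by (simp add: T_def e_def mult.commute)
qed

section \<open>Totient quotients of differences of products\<close>

definition gap :: "nat \<Rightarrow> nat \<Rightarrow> nat" where
  "gap m n = nat \<bar>int m - int n\<bar>"

lemma dvd_gap_iff: "p dvd gap m n \<longleftrightarrow> [n = m] (mod p)"
proof -
  have "p dvd gap m n \<longleftrightarrow> int p dvd int m - int n"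
    unfolding gap_def int_dvd_int_iff[of p, symmetric] by simp
  also have "\<dots> \<longleftrightarrow> [int m = int n] (mod int p)"
    by (simp only: cong_iff_dvd_diff)
  also have "\<dots> \<longleftrightarrow> [m = n] (mod p)"
    by (rule cong_int_iff)
  also have "\<dots> \<longleftrightarrow> [n = m] (mod p)"
    by (rule cong_sym_eq)
  finally show ?thesis .
qed

text \<open>The summand in which $h/\varphi(h)$ is averaged over pairs; coinciding products are left to
  the count of diagonal pairs.\<close>

abbreviation gap_totient_quotient :: "nat \<Rightarrow> nat \<Rightarrow> real" where
  "gap_totient_quotient m n \<equiv> if m = n then 0 else real (gap m n) / real (totient (gap m n))"

text \<open>For fixed \<open>u\<close>, a prime $p \le L$ prime to all \<open>b i\<close> divides the difference for at most
  $2 L^d/e$ tuples \<open>v\<close>, where $e < p \le L$ is the order of \<open>b 1\<close>: the restriction to $p \le L$ is what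
  absorbs the incomplete period. The finitely many primes dividing some \<open>b i\<close> are bounded
  trivially.\<close>

lemma sum_prime_weights_dvd_gap_le:
  fixes b :: "nat \<Rightarrow> nat"
  assumes "d \<ge> 1" and b: "\<And>i. i \<in> {1..d} \<Longrightarrow> b i \<ge> 2"
  shows "\<exists>C\<ge>0. \<forall>L\<ge>1.
          (\<Sum>u\<in>exponent_box d L. \<Sum>v\<in>exponent_box d L.
             \<Sum>p | prime p \<and> p \<le> L \<and> p dvd gap (beta d b u) (beta d b v). real p powr (-2/3))
          \<le> C * real L ^ (2 * d)"
proof -
  define Q where "Q = prime_factors (\<Prod>i\<in>{1..d}. b i)"
  have fQ: "finite Q" by (simp add: Q_def)
  have copQ: "coprime p (b i)" if "prime p" "p \<notin> Q" "i \<in> {1..d}" for p i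
  proof -
    have "b i \<noteq> 0" if "i \<in> {1..d}" for i using b[OF that] by simp
    then have "(\<Prod>i\<in>{1..d}. b i) \<noteq> 0" by simp
    then have "\<not> p dvd (\<Prod>i\<in>{1..d}. b i)"
      using that by (auto simp: Q_def prime_factors_dvd)
    moreover have "b i dvd (\<Prod>i\<in>{1..d}. b i)" using that by (intro dvd_prodI) auto
    ultimately have "\<not> p dvd b i" by (meson dvd_trans)
    then show ?thesis using \<open>prime p\<close> by (simp add: prime_imp_coprime)
  qed
  have "b 1 \<ge> 2" using b \<open>d \<ge> 1\<close> by simp
  from sum_over_orders_bounded[OF this] obtain C where "C \<ge> 0" and
    C: "\<forall>S. finite S \<and> (\<forall>p\<in>S. prime p \<and> coprime p (b 1)) \<longrightarrow>
           (\<Sum>p\<in>S. real p powr (-2/3) / real (ord p (b 1))) \<le> C"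
    by blast
  have main: "(\<Sum>u\<in>exponent_box d L. \<Sum>v\<in>exponent_box d L. \<Sum>p | prime p \<and> p \<le> L \<and> p dvd gap (beta d b u) (beta d b v).
             real p powr (-2/3)) \<le> (real (card Q) + 2 * C) * real L ^ (2 * d)" if "L \<ge> 1" for L
  proof -
    let ?w = "\<lambda>p. real p powr (-2/3)"
    define S where "S = {p. prime p \<and> p \<le> L \<and> p \<notin> Q}"
    define P where "P = {p. prime p \<and> p \<le> L}"
    have fin: "finite S" "finite P" by (simp_all add: S_def P_def)
    define N where "N = (\<lambda>p u. card {v \<in> exponent_box d L. [beta d b v = beta d b u] (mod p)})"
    have inner: "(\<Sum>v\<in>exponent_box d L. \<Sum>p | prime p \<and> p \<le> L \<and> p dvd gap (beta d b u) (beta d b v). ?w p)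
        \<le> (real (card Q) + 2 * C) * real L ^ d" for u
    proof -
      have "(\<Sum>v\<in>exponent_box d L. \<Sum>p | prime p \<and> p \<le> L \<and> p dvd gap (beta d b u) (beta d b v). ?w p)
          = (\<Sum>v\<in>exponent_box d L. \<Sum>p\<in>P. if [beta d b v = beta d b u] (mod p) then ?w p else 0)"
        unfolding sum.inter_filter[OF fin(2), symmetric]
        by (intro sum.cong refl) (auto simp: dvd_gap_iff P_def)
      also have "\<dots> = (\<Sum>p\<in>P. \<Sum>v\<in>exponent_box d L. if [beta d b v = beta d b u] (mod p) then ?w p else 0)"
        by (rule sum.swap)
      also have "\<dots> = (\<Sum>p\<in>P. real (N p u) * ?w p)"
        by (intro sum.cong refl) (simp add: sum.inter_filter[symmetric] N_def)
      also have "\<dots> = (\<Sum>p\<in>S. real (N p u) * ?w p) + (\<Sum>p\<in>P - S. real (N p u) * ?w p)"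
        using fin by (subst sum.subset_diff[of S P]) (auto simp: S_def P_def)
      also have "\<dots> \<le> (\<Sum>p\<in>S. (2 * real L ^ d) * (?w p / real (ord p (b 1)))) + (\<Sum>p\<in>Q. real L ^ d)"
      proof (rule add_mono)
        show "(\<Sum>p\<in>S. real (N p u) * ?w p) \<le> (\<Sum>p\<in>S. (2 * real L ^ d) * (?w p / real (ord p (b 1))))"
        proof (rule sum_mono)
          fix p assume "p \<in> S"
          then have p: "prime p" "p \<le> L" "\<And>i. i \<in> {1..d} \<Longrightarrow> coprime p (b i)"
            using copQ by (auto simp: S_def)
          define e where "e = ord p (b 1)"
          have e: "e > 0" using p(3)[of 1] \<open>d \<ge> 1\<close> by (simp add: e_def)
          have "e dvd totient p"
            unfolding e_def using p(3)[of 1] \<open>d \<ge> 1\<close> by (intro order_divides_totient) simp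
          moreover have "totient p > 0" using p(1) by (simp add: prime_gt_0_nat)
          ultimately have "e \<le> totient p" by (intro dvd_imp_le)
          also have "\<dots> \<le> L" using p totient_le[of p] by linarith
          finally have "e \<le> L" .
          have "real (L div e) \<le> real L / real e" by (rule of_nat_div_le_of_nat)
          moreover have "1 \<le> real L / real e" using e \<open>e \<le> L\<close> by simp
          ultimately have "real (L div e + 1) \<le> 2 * real L / real e" by simp
          have "real (N p u) \<le> real (L ^ (d - 1) * (L div e + 1))"
            unfolding N_def e_def of_nat_le_iff by (rule card_beta_cong_le) (use p \<open>d \<ge> 1\<close> in auto)
          also have "\<dots> = real L ^ (d - 1) * real (L div e + 1)" by (simp add: algebra_simps)
          also have "\<dots> \<le> real L ^ (d - 1) * (2 * real L / real e)"
            by (intro mult_left_mono) (fact, simp)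
          also have "\<dots> = 2 * real L ^ d / real e"
            using \<open>d \<ge> 1\<close> by (cases d) auto
          finally have "real (N p u) * ?w p \<le> (2 * real L ^ d / real e) * ?w p"
            by (rule mult_right_mono) simp
          then show "real (N p u) * ?w p \<le> (2 * real L ^ d) * (?w p / real (ord p (b 1)))"
            by (simp add: e_def)
        qed
        have "(\<Sum>p\<in>P - S. real (N p u) * ?w p) \<le> (\<Sum>p\<in>P - S. real L ^ d * 1)"
        proof (intro sum_mono mult_mono)
          fix p assume "p \<in> P - S"
          then have "p \<ge> 1" by (auto simp: P_def dest: prime_ge_1_nat)
          then show "?w p \<le> 1" using powr_mono2'[of "-2/3" 1 "real p"] by simp
          have "N p u \<le> card (exponent_box d L)" unfolding N_def by (intro card_mono) auto
          then show "real (N p u) \<le> real L ^ d"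
            by (simp only: card_exponent_box of_nat_le_iff[symmetric, where 'a = real] of_nat_power)
        qed auto
        also have "\<dots> \<le> (\<Sum>p\<in>Q. real L ^ d)"
          unfolding mult_1_right using fQ by (intro sum_mono2) (auto simp: S_def P_def)
        finally show "(\<Sum>p\<in>P - S. real (N p u) * ?w p) \<le> (\<Sum>p\<in>Q. real L ^ d)" .
      qed
      also have "\<dots> = (2 * real L ^ d) * (\<Sum>p\<in>S. ?w p / real (ord p (b 1))) + real (card Q) * real L ^ d"
        by (simp only: sum_distrib_left sum_constant)
      also have "\<dots> \<le> (2 * real L ^ d) * C + real (card Q) * real L ^ d"
      proof (intro add_right_mono mult_left_mono)
        have "finite S \<and> (\<forall>p\<in>S. prime p \<and> coprime p (b 1))"
          using fin copQ \<open>d \<ge> 1\<close> by (auto simp: S_def)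
        then show "(\<Sum>p\<in>S. ?w p / real (ord p (b 1))) \<le> C" using C by blast
      qed simp
      finally show ?thesis by (simp add: algebra_simps)
    qed
    have "(\<Sum>u\<in>exponent_box d L. \<Sum>v\<in>exponent_box d L. \<Sum>p | prime p \<and> p \<le> L \<and> p dvd gap (beta d b u) (beta d b v). ?w p)
        \<le> (\<Sum>u\<in>exponent_box d L. (real (card Q) + 2 * C) * real L ^ d)"
      by (rule sum_mono) (rule inner)
    also have "\<dots> = (real (card Q) + 2 * C) * real L ^ (2 * d)"
      by (simp add: card_exponent_box power_even_eq power2_eq_square)
    finally show ?thesis .
  qed
  show ?thesis
  proof (intro exI conjI allI impI)
    show "real (card Q) + 2 * C \<ge> 0" using \<open>C \<ge> 0\<close> by simp
  qed (rule main)
qed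

text \<open>The average of $h/\varphi(h)$ over differences of products is bounded. The products are at
  most $P^L \le 2^{PL}$, where $P$ is the product of the bases, so their differences have only
  $O(L)$ prime factors.\<close>

lemma sum_totient_quotient_gap_le:
  fixes b :: "nat \<Rightarrow> nat"
  assumes "d \<ge> 1" and b: "\<And>i. i \<in> {1..d} \<Longrightarrow> b i \<ge> 2"
  shows "\<exists>K>0. \<forall>L\<ge>1.
          (\<Sum>u\<in>exponent_box d L. \<Sum>v\<in>exponent_box d L.
             gap_totient_quotient (beta d b u) (beta d b v))
          \<le> K * real L ^ (2 * d)"
proof -
  define P where "P = (\<Prod>i\<in>{1..d}. b i)"
  from sum_prime_weights_dvd_gap_le[of d b] assms obtain C where "C \<ge> 0" and
    C: "\<forall>L\<ge>1. (\<Sum>u\<in>exponent_box d L. \<Sum>v\<in>exponent_box d L.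
         \<Sum>p | prime p \<and> p \<le> L \<and> p dvd gap (beta d b u) (beta d b v). real p powr (-2/3))
      \<le> C * real L ^ (2 * d)"
    by blast
  have main: "(\<Sum>u\<in>exponent_box d L. \<Sum>v\<in>exponent_box d L.
             gap_totient_quotient (beta d b u) (beta d b v))
          \<le> exp (real P) * (1 + 10 * C) * real L ^ (2 * d)" if "L \<ge> 1" for L
  proof -
    define s where "s = (\<lambda>u v. \<Sum>p | prime p \<and> p \<le> L \<and> p dvd gap (beta d b u) (beta d b v). real p powr (-2/3))"
    have inner: "gap_totient_quotient (beta d b u) (beta d b v)
        \<le> exp (real P) * (1 + 10 * s u v)"
      if uv: "u \<in> exponent_box d L" "v \<in> exponent_box d L" for u v
    proof (cases "beta d b u = beta d b v")
      case True
      have "s u v \<ge> 0" unfolding s_def by (intro sum_nonneg) simp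
      then show ?thesis using True by simp
    next
      case False
      let ?h = "gap (beta d b u) (beta d b v)"
      have "?h \<ge> 1" using False by (auto simp: gap_def)
      moreover have "?h \<le> 2 ^ (P * L)"
      proof -
        have "beta d b w \<le> P ^ L" if "w \<in> exponent_box d L" for w
          unfolding P_def using that b by (intro beta_exponent_box_le) force+
        from this[OF uv(1)] this[OF uv(2)] have "?h \<le> P ^ L"
          unfolding gap_def by linarith
        also have "\<dots> \<le> (2 ^ P) ^ L" by (intro power_mono) (auto simp: less_imp_le less_exp)
        finally show ?thesis by (simp add: power_mult)
      qed
      ultimately have "real ?h / real (totient ?h) \<le> exp (real (P * L) / real L) * (1 + 10 * s u v)"
        unfolding s_def using \<open>L \<ge> 1\<close> by (intro totient_quotient_bound)
      then show ?thesis using False \<open>L \<ge> 1\<close> by simp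
    qed
    have "(\<Sum>u\<in>exponent_box d L. \<Sum>v\<in>exponent_box d L.
             gap_totient_quotient (beta d b u) (beta d b v))
        \<le> (\<Sum>u\<in>exponent_box d L. \<Sum>v\<in>exponent_box d L. exp (real P) * (1 + 10 * s u v))"
      by (rule sum_mono, rule sum_mono) (rule inner)
    also have "\<dots> = exp (real P) * (real L ^ (2 * d) + 10 * (\<Sum>u\<in>exponent_box d L. \<Sum>v\<in>exponent_box d L. s u v))"
      unfolding power_even_eq[of "real L" d] power2_eq_square
      by (simp add: algebra_simps sum.distrib sum_distrib_left card_exponent_box)
    also have "\<dots> \<le> exp (real P) * (real L ^ (2 * d) + 10 * (C * real L ^ (2 * d)))"
      unfolding s_def using C that by (intro mult_left_mono add_left_mono) auto
    finally show ?thesis by (simp add: algebra_simps)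
  qed
  show ?thesis
  proof (intro exI conjI allI impI)
    show "exp (real P) * (1 + 10 * C) > 0" using \<open>C \<ge> 0\<close> by (intro mult_pos_pos) auto
  qed (rule main)
qed

section \<open>Moments of the number of representations\<close>

lemma finite_upto: "finite {a \<in> A. real a \<le> y}"
  by (rule finite_subset[of _ "{..nat \<lfloor>y\<rfloor>}"]) (auto intro: le_nat_floor)

lemma count_upto_mono: "x \<le> y \<Longrightarrow> count_upto A x \<le> count_upto A y"
  unfolding count_upto_def by (intro card_mono finite_upto) auto

lemma pair_count_mono: "x \<le> y \<Longrightarrow> pair_count A x h \<le> pair_count A y h"
  unfolding pair_count_def
  by (rule card_mono, rule finite_subset[OF _ finite_upto[of A y]]) auto

text \<open>The values hit fewer than \<open>T\<close> times account for at most half of \<open>W\<close>; Cauchy--Schwarz over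
  the remaining ones gives the bound, since the sum of the squared fibre sizes counts
  collisions.\<close>

lemma second_moment_lower_bound:
  fixes f :: "'a \<Rightarrow> 'b" and T :: real
  assumes "finite W" and "finite N" and "f ` W \<subseteq> N" and "T \<ge> 0"
    and T: "real (card N) * T \<le> real (card W) / 2"
  shows "(real (card W))\<^sup>2 / 4
       \<le> real (card {n \<in> N. real (card {w \<in> W. f w = n}) \<ge> T})
         * real (card {(w, w') \<in> W \<times> W. f w = f w'})"
proof -
  define r where "r = (\<lambda>n. real (card {w \<in> W. f w = n}))"
  define G where "G = {n \<in> N. r n \<ge> T}"
  have fin: "finite G" "G \<subseteq> N" using \<open>finite N\<close> by (auto simp: G_def)
  have total: "(\<Sum>n\<in>N. r n) = real (card W)"
    using sum_fun_comp[OF assms(1-3), of "\<lambda>_. 1 :: real"] by (simp add: r_def)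
  have "(\<Sum>n\<in>N - G. r n) \<le> (\<Sum>n\<in>N - G. T)"
    by (intro sum_mono) (auto simp: G_def)
  also have "\<dots> \<le> real (card N) * T"
    using \<open>T \<ge> 0\<close> \<open>finite N\<close> by (auto intro!: mult_right_mono card_mono)
  finally have "real (card W) / 2 \<le> (\<Sum>n\<in>G. r n)"
    using T total sum.subset_diff[OF fin(2) \<open>finite N\<close>, of r] by linarith
  then have "(real (card W) / 2)\<^sup>2 \<le> (\<Sum>n\<in>G. r n)\<^sup>2" by (intro power_mono) auto
  also have "\<dots> \<le> (\<Sum>n\<in>G. (r n)\<^sup>2) * real (card G)"
    by (rule sum_squared_le_sum_of_squares)
  also have "(\<Sum>n\<in>G. (r n)\<^sup>2) \<le> (\<Sum>n\<in>N. (r n)\<^sup>2)"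
    using fin \<open>finite N\<close> by (intro sum_mono2) auto
  also have "(\<Sum>n\<in>N. (r n)\<^sup>2) = (\<Sum>w\<in>W. r (f w))"
    using sum_fun_comp[OF assms(1-3), of r] by (simp add: r_def power2_eq_square)
  also have "\<dots> = real (card (SIGMA w:W. {w' \<in> W. f w' = f w}))"
    using \<open>finite W\<close> by (simp add: r_def)
  also have "(SIGMA w:W. {w' \<in> W. f w' = f w}) = {(w, w') \<in> W \<times> W. f w = f w'}"
    by auto
  finally show ?thesis
    by (simp add: power_divide mult.commute G_def r_def mult_right_mono)
qed

text \<open>A coincidence $a + m = a' + n$ makes the smaller of \<open>a\<close>, \<open>a'\<close> an element of \<open>A\<close> whose
  translate by the gap also lies in \<open>A\<close>, and it determines the other.\<close>

lemma card_translates_meeting_le: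
  fixes A :: "nat set" and m n :: nat
  assumes "m \<noteq> n"
  shows "card {a \<in> A. real a \<le> y \<and> (\<exists>a'\<in>A. real a' \<le> y \<and> a + m = a' + n)} \<le> pair_count A y (gap m n)"
proof -
  define h where "h = gap m n"
  define D where "D = {a \<in> A. real a \<le> y \<and> a + h \<in> A}"
  have fin: "finite D"
    by (rule finite_subset[OF _ finite_upto[of A y]]) (auto simp: D_def)
  show ?thesis
  proof (cases "m > n")
    case True
    then have "h = m - n" by (simp add: h_def gap_def)
    then have "a + h = a'" if "a + m = a' + n" for a a'
      using True that by linarith
    then have "{a \<in> A. real a \<le> y \<and> (\<exists>a'\<in>A. real a' \<le> y \<and> a + m = a' + n)} \<subseteq> D"
      unfolding D_def by blast
    then show ?thesis using fin unfolding pair_count_def D_def h_def by (intro card_mono)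
  next
    case False
    then have "h = n - m" by (simp add: h_def gap_def)
    then have "a = a' + h" if "a + m = a' + n" for a a'
      using False that by linarith
    then have "{a \<in> A. real a \<le> y \<and> (\<exists>a'\<in>A. real a' \<le> y \<and> a + m = a' + n)} \<subseteq> (\<lambda>a'. a' + h) ` D"
      unfolding D_def by blast
    then have "card {a \<in> A. real a \<le> y \<and> (\<exists>a'\<in>A. real a' \<le> y \<and> a + m = a' + n)} \<le> card ((\<lambda>a'. a' + h) ` D)"
      using fin by (intro card_mono) auto
    also have "\<dots> \<le> card D" using fin by (rule card_image_le)
    finally show ?thesis unfolding pair_count_def D_def h_def .
  qed
qed

lemma card_collisions_le:
  fixes A :: "nat set" and g :: "'u \<Rightarrow> nat" and y :: real
  assumes "finite U"
  defines "W \<equiv> {a \<in> A. real a \<le> y} \<times> U"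
  shows "card {(w, w') \<in> W \<times> W. fst w + g (snd w) = fst w' + g (snd w')}
       \<le> (\<Sum>u\<in>U. \<Sum>v\<in>U. if g u = g v then count_upto A y else pair_count A y (gap (g u) (g v)))"
proof -
  define X where "X = {a \<in> A. real a \<le> y}"
  define D where "D = (\<lambda>u v. {a \<in> X. \<exists>a'\<in>X. a + g u = a' + g v})"
  have fX: "finite X" unfolding X_def by (rule finite_upto)
  have "{(w, w') \<in> W \<times> W. fst w + g (snd w) = fst w' + g (snd w')}
      \<subseteq> (\<Union>(u, v)\<in>U \<times> U. (\<lambda>a. ((a, u), (a + g u - g v, v))) ` D u v)"
  proof clarify
    fix a u a' v
    assume "(a, u) \<in> W" "(a', v) \<in> W" and eq: "fst (a, u) + g (snd (a, u)) = fst (a', v) + g (snd (a', v))"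
    then have "a \<in> X" "a' \<in> X" "u \<in> U" "v \<in> U" by (simp_all add: W_def X_def)
    then have "a \<in> D u v" using eq by (auto simp: D_def)
    moreover have "a' = a + g u - g v" using eq by simp
    ultimately have "((a, u), (a', v)) \<in> (\<lambda>a. ((a, u), (a + g u - g v, v))) ` D u v" by blast
    then show "((a, u), (a', v)) \<in> (\<Union>(u, v)\<in>U \<times> U. (\<lambda>a. ((a, u), (a + g u - g v, v))) ` D u v)"
      using \<open>u \<in> U\<close> \<open>v \<in> U\<close> by blast
  qed
  then have "card {(w, w') \<in> W \<times> W. fst w + g (snd w) = fst w' + g (snd w')}
      \<le> card (\<Union>(u, v)\<in>U \<times> U. (\<lambda>a. ((a, u), (a + g u - g v, v))) ` D u v)"
    using \<open>finite U\<close> fX by (intro card_mono) (auto simp: D_def)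
  also have "\<dots> \<le> (\<Sum>(u, v)\<in>U \<times> U. card ((\<lambda>a. ((a, u), (a + g u - g v, v))) ` D u v))"
    using \<open>finite U\<close> card_UN_le[of "U \<times> U" "\<lambda>(u, v). (\<lambda>a. ((a, u), (a + g u - g v, v))) ` D u v"]
    by (simp add: case_prod_unfold)
  also have "\<dots> \<le> (\<Sum>(u, v)\<in>U \<times> U.
      if g u = g v then count_upto A y else pair_count A y (gap (g u) (g v)))"
  proof (intro sum_mono, clarify)
    fix u v
    have "card ((\<lambda>a. ((a, u), (a + g u - g v, v))) ` D u v) \<le> card (D u v)"
      using fX by (intro card_image_le) (simp add: D_def)
    also have "\<dots> \<le> (if g u = g v then count_upto A y else pair_count A y (gap (g u) (g v)))"
    proof (cases "g u = g v")
      case True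
      have "card (D u v) \<le> card X" using fX by (intro card_mono) (auto simp: D_def)
      then show ?thesis using True by (simp add: count_upto_def X_def)
    next
      case False
      have "D u v = {a \<in> A. real a \<le> y \<and> (\<exists>a'\<in>A. real a' \<le> y \<and> a + g u = a' + g v)}"
        by (auto simp: D_def X_def)
      then show ?thesis
        using card_translates_meeting_le[OF False, of A y] False by simp
    qed
    finally show "card ((\<lambda>a. ((a, u), (a + g u - g v, v))) ` D u v)
        \<le> (if g u = g v then count_upto A y else pair_count A y (gap (g u) (g v)))" .
  qed
  also have "\<dots> = (\<Sum>u\<in>U. \<Sum>v\<in>U. if g u = g v then count_upto A y else pair_count A y (gap (g u) (g v)))"
    by (simp add: sum.cartesian_product)
  finally show ?thesis .
qed

section \<open>The main theorem\<close>

lemma finite_representations: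
  assumes b: "\<And>i. i \<in> {1..d} \<Longrightarrow> b i \<ge> 2"
  shows "finite {(a, u) \<in> A \<times> exponent_tuples d. a + beta d b u = n}"
proof (rule finite_subset)
  show "finite ({..n} \<times> ({1..d} \<rightarrow>\<^sub>E {..n}))" by (intro finite_cartesian_product finite_PiE) auto
  have "u i \<le> n" if "beta d b u \<le> n" "i \<in> {1..d}" for u i
  proof -
    have "u i \<le> b i ^ u i"
      using less_exp[of "u i"] power_mono[of 2 "b i" "u i"] b[OF that(2)] by linarith
    also have "\<dots> \<le> beta d b u"
    proof (rule dvd_imp_le)
      show "b i ^ u i dvd beta d b u" unfolding beta_def using that(2) by (intro dvd_prodI) auto
      show "beta d b u > 0" unfolding beta_def
        by (intro prod_pos) (use b in \<open>force intro: zero_less_power\<close>)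
    qed
    finally show ?thesis using that by simp
  qed
  then show "{(a, u) \<in> A \<times> exponent_tuples d. a + beta d b u = n} \<subseteq> {..n} \<times> ({1..d} \<rightarrow>\<^sub>E {..n})"
    by (auto simp: exponent_tuples_def PiE_iff extensional_def)
qed

lemma mult_rank_attained:
  "\<exists>I. I \<subseteq> {1..d} \<and> mult_indep I b \<and> card I = mult_rank d b"
proof -
  define F where "F = {I. I \<subseteq> {1..d} \<and> mult_indep I b}"
  have "finite F"
    by (rule finite_subset[of _ "Pow {1..d}"]) (auto simp: F_def)
  moreover have "{} \<in> F" by (simp add: F_def mult_indep_def)
  ultimately have "Max (card ` F) \<in> card ` F"
    by (intro Max_in) blast+
  then obtain I where "I \<in> F" "Max (card ` F) = card I" by (rule imageE)
  then show ?thesis unfolding F_def mult_rank_def by (intro exI[of _ I]) simp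
qed

text \<open>The witness is $L = \lfloor \log(x/2) / \log P \rfloor$, the largest box whose products stay
  below $x/2$. Weakening $\log P$ to $P$ keeps the constant at least 1.\<close>

lemma eventually_box_size:
  fixes P :: nat
  assumes "P \<ge> 2"
  shows "\<forall>\<^sub>F x in at_top. \<exists>L\<ge>1. real P ^ L \<le> x / 2 \<and> ln x \<le> 2 * real P * real L"
proof -
  have lnP: "ln (real P) > 0" using assms by simp
  have "\<forall>\<^sub>F x :: real in at_top. ln x \<ge> 2 * ln 2 + 2 * ln (real P)"
    using ln_at_top by (simp add: filterlim_at_top)
  then have "\<forall>\<^sub>F x :: real in at_top. ln x \<ge> 2 * ln 2 + 2 * ln (real P) \<and> x > 1"
    by (intro eventually_conj eventually_gt_at_top)
  then show ?thesis
  proof (rule eventually_mono)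
    fix x :: real
    assume elim: "ln x \<ge> 2 * ln 2 + 2 * ln (real P) \<and> x > 1"
    define t where "t = ln (x / 2) / ln (real P)"
    define L where "L = nat \<lfloor>t\<rfloor>"
    have lnx: "ln (x / 2) = ln x - ln 2" using elim by (simp add: ln_div)
    have "ln (x / 2) \<ge> 0" using elim lnP ln_gt_zero[of "2 :: real"] unfolding lnx by linarith
    then have "t \<ge> 0" using lnP by (simp add: t_def)
    then have L: "real L \<le> t" "t < real L + 1" by (simp_all add: L_def)
    have "real L * ln (real P) \<le> ln (x / 2)"
      using L(1) lnP by (simp add: t_def pos_le_divide_eq)
    then have "ln (real P ^ L) \<le> ln (x / 2)" using assms by (simp add: ln_realpow)
    then have 1: "real P ^ L \<le> x / 2" 
      by (rule iffD1[OF ln_le_cancel_iff, rotated 2]) (use assms elim in auto)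
    have "ln (x / 2) < (real L + 1) * ln (real P)"
      using L(2) lnP by (simp add: t_def pos_divide_less_eq)
    then have "ln x \<le> 2 * ln (real P) * real L"
      using elim unfolding lnx by (simp add: algebra_simps)
    also have "\<dots> \<le> 2 * real P * real L"
    proof (rule mult_right_mono)
      show "2 * ln (real P) \<le> 2 * real P" using ln_bound[of "real P"] assms by simp
    qed simp
    finally have 2: "ln x \<le> 2 * real P * real L" .
    have "ln x > 0" using elim by simp
    then have "L \<noteq> 0" using 2 by (intro notI) simp
    then have "L \<ge> 1" by simp
    with 1 2 show "\<exists>L\<ge>1. real P ^ L \<le> x / 2 \<and> ln x \<le> 2 * real P * real L" by blast
  qed
qed

text \<open>The final arithmetic: \<open>V\<close> is the number of exponent tuples, \<open>E\<close> stands for $L^k$ and \<open>Z\<close>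
  for the number $L^{2d-k}$ of diagonal pairs, \<open>w\<close> is the first moment, \<open>q\<close> the second, and \<open>l\<close> is
  $(\log x)^k$. The last steps use that $l/(l + \eta)$ increases with \<open>l\<close>.\<close>

lemma density_from_moments:
  fixes a B C E V Z g l q t w x \<eta> :: real
  assumes pos: "a > 0" "B > 0" "C > 0" "E > 0" "V > 0" "x > 0" "\<eta> > 0" "t \<ge> 1" "l \<ge> 0" "g \<ge> 0"
    and first: "w \<ge> a * x * V / \<eta>"
    and cs: "w\<^sup>2 / 4 \<le> g * q"
    and second: "q \<le> C * (x / \<eta>) * Z + B * (x / \<eta>\<^sup>2) * V\<^sup>2"
    and Z: "Z * E = V\<^sup>2"
    and l: "l \<le> t * E"
  shows "a\<^sup>2 / (4 * (B + C) * t) * x * (l / (l + \<eta>)) \<le> g"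
proof -
  have Z': "Z = V\<^sup>2 / E" using Z pos by (simp add: field_simps)
  define Y where "Y = x * V\<^sup>2 / \<eta>\<^sup>2"
  have Y: "Y > 0" using pos by (simp add: Y_def)
  have "(a * x * V / \<eta>)\<^sup>2 \<le> w\<^sup>2" using first pos by (intro power_mono) auto
  moreover have "(a * x * V / \<eta>)\<^sup>2 = a\<^sup>2 * x * Y"
    by (simp add: Y_def power_divide power_mult_distrib power2_eq_square)
  ultimately have 1: "a\<^sup>2 * x * Y / 4 \<le> g * q" using cs by simp
  define M where "M = (B + C) * (E + \<eta>) / E"
  have "q \<le> Y * (C * \<eta> / E + B)"
    using second pos unfolding Z' Y_def by (simp add: field_simps power2_eq_square)
  also have "\<dots> \<le> Y * M"
    using pos Y unfolding M_def by (intro mult_left_mono) (auto simp: field_simps)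
  finally have "g * q \<le> g * (Y * M)"
    using pos by (intro mult_left_mono) auto
  moreover have "g * (Y * M) = Y * (g * M)" and "a\<^sup>2 * x * Y / 4 = Y * (a\<^sup>2 * x / 4)"
    by simp_all
  ultimately have "Y * (a\<^sup>2 * x / 4) \<le> Y * (g * M)" using 1 by linarith
  then have "a\<^sup>2 * x / 4 \<le> g * M" using Y by (simp only: mult_le_cancel_left_pos)
  moreover define D F where "D = B + C" and "F = E + \<eta>"
  ultimately have "a\<^sup>2 * x / 4 \<le> g * (D * F / E)" and "D > 0" "F > 0"
    using pos by (simp_all add: M_def)
  then have "a\<^sup>2 / (4 * D) * x * (E / F) \<le> g"
    using pos by (simp add: divide_simps mult_ac)
  then have 2: "a\<^sup>2 / (4 * (B + C)) * x * (E / (E + \<eta>)) \<le> g"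
    by (simp only: D_def F_def)
  define p where "p = t * E"
  have p: "p + \<eta> > 0" "l + \<eta> > 0" using pos by (simp_all add: p_def add_pos_pos)
  have "l * \<eta> \<le> p * \<eta>" using l pos by (simp add: p_def mult_right_mono)
  then have "l * (p + \<eta>) \<le> p * (l + \<eta>)" by (simp add: algebra_simps)
  then have "l / (l + \<eta>) \<le> p / (p + \<eta>)" using p by (simp add: pos_divide_le_eq pos_le_divide_eq)
  then have "l / (l + \<eta>) \<le> (t * E) / (t * E + \<eta>)" unfolding p_def .
  also have "\<dots> \<le> t * (E / (E + \<eta>))"
  proof -
    have "t * E / (t * E + \<eta>) \<le> t * E / (E + \<eta>)"
      using pos by (intro divide_left_mono mult_pos_pos add_pos_pos) auto
    then show ?thesis by simp
  qed
  finally have "a\<^sup>2 / (4 * (B + C) * t) * x * (l / (l + \<eta>))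
      \<le> a\<^sup>2 / (4 * (B + C) * t) * x * (t * (E / (E + \<eta>)))"
    using pos by (intro mult_left_mono) auto
  also have "\<dots> = a\<^sup>2 / (4 * (B + C)) * x * (E / (E + \<eta>))" using pos by simp
  finally show ?thesis using 2 by linarith
qed

text \<open>Pairs of tuples with equal products force equal elements of \<open>A\<close>, and independence makes such
  pairs rare; the others are governed by the pair count of \<open>A\<close>, whose dependence on $h$ is harmless on
  average.\<close>

lemma card_box_collisions_le:
  fixes A :: "nat set" and b :: "nat \<Rightarrow> nat" and x y H K M :: real
  assumes b: "\<And>i. i \<in> {1..d} \<Longrightarrow> b i \<ge> 2"
    and I: "I \<subseteq> {1..d}" "mult_indep I b"
    and "y \<le> x" and "H \<ge> 0"
    and count: "real (count_upto A x) \<le> M"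
    and pairs: "\<And>h. h \<ge> 1 \<Longrightarrow> real (pair_count A x h) \<le> H * (real h / real (totient h))"
    and K: "(\<Sum>u\<in>exponent_box d L. \<Sum>v\<in>exponent_box d L.
               gap_totient_quotient (beta d b u) (beta d b v))
            \<le> K * real L ^ (2 * d)"
  defines "W \<equiv> {a \<in> A. real a \<le> y} \<times> exponent_box d L"
  shows "real (card {(w, w') \<in> W \<times> W. fst w + beta d b (snd w) = fst w' + beta d b (snd w')})
       \<le> M * (real L ^ d * real L ^ (d - card I)) + H * K * real L ^ (2 * d)"
proof -
  let ?U = "exponent_box d L" and ?\<beta> = "beta d b"
  define t where "t = (\<lambda>u v. if ?\<beta> u = ?\<beta> v then 0
     else real (gap (?\<beta> u) (?\<beta> v)) / real (totient (gap (?\<beta> u) (?\<beta> v))))"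
  define e where "e = (\<lambda>u v. if ?\<beta> v = ?\<beta> u then M else 0)"
  have "M \<ge> 0" using count by linarith
  have b1: "b i \<ge> 1" if "i \<in> {1..d}" for i using b[OF that] by simp
  have "card {(w, w') \<in> W \<times> W. fst w + ?\<beta> (snd w) = fst w' + ?\<beta> (snd w')}
      \<le> (\<Sum>u\<in>?U. \<Sum>v\<in>?U. if ?\<beta> u = ?\<beta> v then count_upto A y else pair_count A y (gap (?\<beta> u) (?\<beta> v)))"
    unfolding W_def by (rule card_collisions_le) simp
  then have "real (card {(w, w') \<in> W \<times> W. fst w + ?\<beta> (snd w) = fst w' + ?\<beta> (snd w')})
      \<le> real (\<Sum>u\<in>?U. \<Sum>v\<in>?U. if ?\<beta> u = ?\<beta> v then count_upto A y else pair_count A y (gap (?\<beta> u) (?\<beta> v)))"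
    by (simp only: of_nat_le_iff)
  also have "\<dots> = (\<Sum>u\<in>?U. \<Sum>v\<in>?U. real (if ?\<beta> u = ?\<beta> v then count_upto A y else pair_count A y (gap (?\<beta> u) (?\<beta> v))))"
    by (simp only: of_nat_sum)
  also have "\<dots> \<le> (\<Sum>u\<in>?U. \<Sum>v\<in>?U. e u v + H * t u v)"
  proof (rule sum_mono, rule sum_mono)
    fix u v
    show "real (if ?\<beta> u = ?\<beta> v then count_upto A y else pair_count A y (gap (?\<beta> u) (?\<beta> v)))
        \<le> e u v + H * t u v"
    proof (cases "?\<beta> u = ?\<beta> v")
      case True
      have "real (count_upto A y) \<le> real (count_upto A x)"
        using count_upto_mono[OF \<open>y \<le> x\<close>] by simp
      then show ?thesis using True count by (simp add: e_def t_def)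
    next
      case False
      define h where "h = gap (?\<beta> u) (?\<beta> v)"
      have "h \<ge> 1" using False by (auto simp: h_def gap_def)
      have "real (pair_count A y h) \<le> real (pair_count A x h)"
        using pair_count_mono[OF \<open>y \<le> x\<close>] by simp
      also have "\<dots> \<le> H * (real h / real (totient h))" by (rule pairs) fact
      finally show ?thesis using False by (simp add: e_def t_def h_def)
    qed
  qed
  also have "\<dots> = (\<Sum>u\<in>?U. \<Sum>v\<in>?U. e u v) + H * (\<Sum>u\<in>?U. \<Sum>v\<in>?U. t u v)"
    by (simp only: sum.distrib sum_distrib_left)
  also have "\<dots> \<le> (\<Sum>u\<in>?U. M * real L ^ (d - card I)) + H * (K * real L ^ (2 * d))"
  proof (intro add_mono mult_left_mono)
    show "(\<Sum>u\<in>?U. \<Sum>v\<in>?U. t u v) \<le> K * real L ^ (2 * d)" using K by (simp only: t_def)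
    show "(\<Sum>u\<in>?U. \<Sum>v\<in>?U. e u v) \<le> (\<Sum>u\<in>?U. M * real L ^ (d - card I))"
    proof (rule sum_mono)
      fix u
      have "(\<Sum>v\<in>?U. e u v) = (\<Sum>v\<in>{v \<in> ?U. ?\<beta> v = ?\<beta> u}. M)"
        unfolding e_def by (rule sum.inter_filter[symmetric]) simp
      also have "\<dots> = M * real (card {v \<in> ?U. ?\<beta> v = ?\<beta> u})" by simp
      also have "\<dots> \<le> M * real (L ^ (d - card I))"
      proof (rule mult_left_mono)
        show "real (card {v \<in> ?U. ?\<beta> v = ?\<beta> u}) \<le> real (L ^ (d - card I))"
          unfolding of_nat_le_iff using b1 I by (rule card_beta_eq_le)
      qed fact
      finally show "(\<Sum>v\<in>?U. e u v) \<le> M * real L ^ (d - card I)" by simp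
    qed
  qed fact
  also have "\<dots> = M * (real L ^ d * real L ^ (d - card I)) + H * K * real L ^ (2 * d)"
    by (simp add: card_exponent_box)
  finally show ?thesis .
qed

text \<open>The counting argument for one value of $x$, with \<open>l\<close> for $\log x$ and \<open>q\<close> for the ratio
  between $\log x$ and the side of the box. The threshold is at most half the
  average over $n \le x$ that the first moment guarantees.\<close>

lemma many_popular_values:
  fixes d L k :: nat and b :: "nat \<Rightarrow> nat" and A :: "nat set" and x \<eta> l q C1 C2 C3 C4 K :: real
  assumes "d \<ge> 1" and b: "\<And>i. i \<in> {1..d} \<Longrightarrow> b i \<ge> 2"
    and I: "I \<subseteq> {1..d}" "mult_indep I b" "card I = k"
    and C: "C1 > 0" "C2 > 0" "C3 > 0" "C4 > 0"
    and "x > 0" and "\<eta> > 0" and "l \<ge> 0" and "q \<ge> 1" and "K > 0"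
    and K: "(\<Sum>u\<in>exponent_box d L. \<Sum>v\<in>exponent_box d L.
               gap_totient_quotient (beta d b u) (beta d b v))
            \<le> K * real L ^ (2 * d)"
    and "L \<ge> 1" and small: "real (\<Prod>i\<in>{1..d}. b i) ^ L \<le> x / 2" and large: "l \<le> q * real L"
    and lower: "C1 * x / \<eta> \<le> real (count_upto A x)"
    and upper: "real (count_upto A x) \<le> C2 * x / \<eta>"
    and half: "C3 * real (count_upto A x) \<le> real (count_upto A (x / 2))"
    and pairs: "\<And>h. h \<ge> 1 \<Longrightarrow>
      real (pair_count A x h) \<le> C4 * (real h / real (totient h)) * (x / \<eta>\<^sup>2)"
  shows "(C1 * C3)\<^sup>2 / (4 * (C4 * K + C2) * q ^ k) * x * (l ^ k / (l ^ k + \<eta>))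
       \<le> real (card {n. 1 \<le> n \<and> real n \<le> x \<and>
            C1 * C3 / (2 * q ^ d) * (l ^ d / \<eta>) \<le> real (rep_count d b A n)})"
proof -
  let ?\<beta> = "beta d b"
  define N where "N = {n :: nat. 1 \<le> n \<and> real n \<le> x}"
  define W where "W = {a \<in> A. real a \<le> x / 2} \<times> exponent_box d L"
  define f where "f = (\<lambda>w. fst w + ?\<beta> (snd w))"
  define T where "T = C1 * C3 / (2 * q ^ d) * (l ^ d / \<eta>)"
  define Z where "Z = real L ^ d * real L ^ (d - k)"
  have "k \<le> d" using card_mono[OF _ I(1)] I(3) by simp
  have finW: "finite W" unfolding W_def by (intro finite_cartesian_product finite_upto) simp
  have finN: "finite N"
    by (rule finite_subset[OF _ finite_upto[of UNIV x]]) (auto simp: N_def)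
  have cardN: "real (card N) \<le> x"
  proof -
    have "N \<subseteq> {1..nat \<lfloor>x\<rfloor>}" by (auto simp: N_def le_nat_floor)
    then have "card N \<le> nat \<lfloor>x\<rfloor>" using card_mono[of "{1..nat \<lfloor>x\<rfloor>}" N] by simp
    then show ?thesis using \<open>x > 0\<close> by linarith
  qed
  have pos: "?\<beta> u \<ge> 1" for u
  proof -
    have "?\<beta> u > 0" unfolding beta_def by (rule prod_pos) (use b in force)
    then show ?thesis by simp
  qed
  have "f w \<in> N" if "w \<in> W" for w
  proof -
    obtain a u where w: "w = (a, u)" "real a \<le> x / 2" "u \<in> exponent_box d L"
      using \<open>w \<in> W\<close> unfolding W_def by blast
    have "?\<beta> u \<le> (\<Prod>i\<in>{1..d}. b i) ^ L"
      using w(3) by (rule beta_exponent_box_le) (use b in force)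
    then have "real (?\<beta> u) \<le> real (\<Prod>i\<in>{1..d}. b i) ^ L"
      by (simp only: of_nat_le_iff flip: of_nat_power)
    then have "real (?\<beta> u) \<le> x / 2"
      using small by (rule order_trans)
    then show ?thesis using w pos[of u] by (simp add: f_def N_def)
  qed
  then have fW: "f ` W \<subseteq> N" by blast
  have cardW: "real (card W) = real (count_upto A (x / 2)) * real L ^ d"
    by (simp add: W_def card_cartesian_product card_exponent_box count_upto_def)
  have first: "real (card W) \<ge> C1 * C3 * x * real L ^ d / \<eta>"
  proof -
    have "C3 * (C1 * x / \<eta>) \<le> C3 * real (count_upto A x)"
      using lower C by (intro mult_left_mono) auto
    then have "C3 * (C1 * x / \<eta>) \<le> real (count_upto A (x / 2))" using half by linarith
    then have "C3 * (C1 * x / \<eta>) * real L ^ d \<le> real (count_upto A (x / 2)) * real L ^ d"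
      by (rule mult_right_mono) simp
    then show ?thesis unfolding cardW by (simp add: mult_ac)
  qed
  have T: "T \<ge> 0" using C \<open>l \<ge> 0\<close> \<open>\<eta> > 0\<close> \<open>q \<ge> 1\<close> by (simp add: T_def)
  have "x * T \<le> real (card W) / 2"
  proof -
    have "l ^ d \<le> q ^ d * real L ^ d"
      using power_mono[OF large \<open>l \<ge> 0\<close>, of d] by (simp add: power_mult_distrib)
    then have "l ^ d / q ^ d \<le> real L ^ d"
      using \<open>q \<ge> 1\<close> by (simp add: pos_divide_le_eq mult.commute)
    then have "(C1 * C3 * x / (2 * \<eta>)) * (l ^ d / q ^ d) \<le> (C1 * C3 * x / (2 * \<eta>)) * real L ^ d"
      using C \<open>x > 0\<close> \<open>\<eta> > 0\<close> by (intro mult_left_mono) auto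
    also have "\<dots> = (C1 * C3 * x * real L ^ d / \<eta>) / 2" by simp
    also have "\<dots> \<le> real (card W) / 2" using first by (rule divide_right_mono) simp
    finally show ?thesis by (simp add: T_def mult_ac)
  qed
  moreover have "real (card N) * T \<le> x * T" using cardN T by (rule mult_right_mono)
  ultimately have "real (card N) * T \<le> real (card W) / 2" by linarith
  from second_moment_lower_bound[OF finW finN fW T this]
  have cs: "(real (card W))\<^sup>2 / 4
      \<le> real (card {n \<in> N. real (card {w \<in> W. f w = n}) \<ge> T})
        * real (card {(w, w') \<in> W \<times> W. f w = f w'})" .
  have second: "real (card {(w, w') \<in> W \<times> W. f w = f w'})
      \<le> C2 * (x / \<eta>) * Z + C4 * K * (x / \<eta>\<^sup>2) * (real L ^ d)\<^sup>2"
  proof -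
    have "real (card {(w, w') \<in> W \<times> W. f w = f w'})
        \<le> (C2 * x / \<eta>) * (real L ^ d * real L ^ (d - card I)) + (C4 * (x / \<eta>\<^sup>2)) * K * real L ^ (2 * d)"
      unfolding W_def f_def
    proof (rule card_box_collisions_le[where b = b, OF b I(1,2) _ _ upper _ K])
      show "real (pair_count A x h) \<le> C4 * (x / \<eta>\<^sup>2) * (real h / real (totient h))" if "h \<ge> 1" for h
        using pairs[OF that] by (simp only: mult_ac)
    qed (use C \<open>x > 0\<close> in auto)
    also have "\<dots> = C2 * (x / \<eta>) * Z + C4 * K * (x / \<eta>\<^sup>2) * (real L ^ d)\<^sup>2"
      by (simp add: Z_def I(3) power_even_eq)
    finally show ?thesis .
  qed
  have "Z * real L ^ k = (real L ^ d)\<^sup>2"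
    using \<open>k \<le> d\<close> by (simp add: Z_def power2_eq_square power_add[symmetric])
  moreover have "l ^ k \<le> q ^ k * real L ^ k"
    using power_mono[OF large \<open>l \<ge> 0\<close>, of k] by (simp add: power_mult_distrib)
  ultimately have "(C1 * C3)\<^sup>2 / (4 * (C4 * K + C2) * q ^ k) * x * (l ^ k / (l ^ k + \<eta>))
      \<le> real (card {n \<in> N. real (card {w \<in> W. f w = n}) \<ge> T})"
    using C \<open>K > 0\<close> \<open>L \<ge> 1\<close> \<open>x > 0\<close> \<open>\<eta> > 0\<close> \<open>q \<ge> 1\<close> \<open>l \<ge> 0\<close>
    by (intro density_from_moments[OF _ _ _ _ _ _ _ _ _ _ first cs second]) auto
  also have "\<dots> \<le> real (card {n. 1 \<le> n \<and> real n \<le> x \<and> T \<le> real (rep_count d b A n)})"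
  proof -
    have "{n \<in> N. real (card {w \<in> W. f w = n}) \<ge> T}
        \<subseteq> {n. 1 \<le> n \<and> real n \<le> x \<and> T \<le> real (rep_count d b A n)}"
    proof
      fix n assume n: "n \<in> {n \<in> N. real (card {w \<in> W. f w = n}) \<ge> T}"
      have "card {w \<in> W. f w = n} \<le> rep_count d b A n"
        unfolding rep_count_def
      proof (rule card_mono)
        show "finite {(a, u). (a, u) \<in> A \<times> exponent_tuples d \<and> a + ?\<beta> u = n}"
          using b by (rule finite_representations)
        show "{w \<in> W. f w = n} \<subseteq> {(a, u). (a, u) \<in> A \<times> exponent_tuples d \<and> a + ?\<beta> u = n}"
          using exponent_box_subset_exponent_tuples[of d L] by (auto simp: W_def f_def)
      qed
      then show "n \<in> {n. 1 \<le> n \<and> real n \<le> x \<and> T \<le> real (rep_count d b A n)}"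
        using n by (simp add: N_def)
    qed
    moreover have "finite {n. 1 \<le> n \<and> real n \<le> x \<and> T \<le> real (rep_count d b A n)}"
      by (rule finite_subset[OF _ finN]) (auto simp: N_def)
    ultimately show ?thesis unfolding of_nat_le_iff by (intro card_mono)
  qed
  finally show ?thesis unfolding T_def .
qed

theorem theorem1p1:
  fixes d :: nat and b :: "nat \<Rightarrow> nat" and C1 C2 C3 C4 :: real
  assumes "d \<ge> 1"
    and "b \<in> {1..d} \<rightarrow>\<^sub>E {2..}"
    and "C1 > 0" and "C2 > 0" and "C3 > 0" and "C4 > 0"
  shows "\<exists>c1>0. \<exists>c2>0. \<forall>(A :: nat set) (eta :: real \<Rightarrow> real) (x0 :: real).
           infinite A \<longrightarrow> 0 \<notin> A \<longrightarrow> density_hyps C1 C2 C3 C4 A eta x0 \<longrightarrow>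
           (\<forall>\<^sub>F x in at_top.
              real (card {n :: nat. 1 \<le> n \<and> real n \<le> x \<and>
                            real (rep_count d b A n) \<ge> c1 * (ln x ^ d / eta x)})
              \<ge> c2 * x * (ln x ^ mult_rank d b / (ln x ^ mult_rank d b + eta x)))"
proof -
  define k where "k = mult_rank d b"
  define P where "P = (\<Prod>i\<in>{1..d}. b i)"
  define q where "q = 2 * real P"
  have b: "b i \<ge> 2" if "i \<in> {1..d}" for i using assms(2) that by (auto simp: PiE_iff)
  have "P \<ge> 2"
  proof -
    have "b 1 dvd P" unfolding P_def using \<open>d \<ge> 1\<close> by (intro dvd_prodI) auto
    moreover have "P > 0" unfolding P_def by (rule prod_pos) (use b in force)
    ultimately have "b 1 \<le> P" by (rule dvd_imp_le)
    then show ?thesis using b[of 1] \<open>d \<ge> 1\<close> by simp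
  qed
  then have "q \<ge> 1" by (simp add: q_def)
  obtain I where I: "I \<subseteq> {1..d}" "mult_indep I b" "card I = k"
    using mult_rank_attained[of d b] unfolding k_def by blast
  from sum_totient_quotient_gap_le[where b = b, OF \<open>d \<ge> 1\<close> b] obtain K where "K > 0" and
    K: "\<forall>L\<ge>1. (\<Sum>u\<in>exponent_box d L. \<Sum>v\<in>exponent_box d L.
             gap_totient_quotient (beta d b u) (beta d b v))
          \<le> K * real L ^ (2 * d)"
    by blast
  define c1 where "c1 = C1 * C3 / (2 * q ^ d)"
  define c2 where "c2 = (C1 * C3)\<^sup>2 / (4 * (C4 * K + C2) * q ^ k)"
  have "c1 > 0" using assms \<open>q \<ge> 1\<close> by (simp add: c1_def)
  have "c2 > 0" using assms \<open>q \<ge> 1\<close> \<open>K > 0\<close> by (simp add: c2_def add_pos_pos)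
  have main: "\<forall>\<^sub>F x in at_top. c2 * x * (ln x ^ k / (ln x ^ k + eta x))
      \<le> real (card {n :: nat. 1 \<le> n \<and> real n \<le> x \<and>
                            c1 * (ln x ^ d / eta x) \<le> real (rep_count d b A n)})"
    if hyp: "density_hyps C1 C2 C3 C4 A eta x0" for A eta x0
  proof -
    have "\<forall>\<^sub>F x in at_top. (\<exists>L\<ge>1. real P ^ L \<le> x / 2 \<and> ln x \<le> q * real L) \<and> x \<ge> x0 \<and> x \<ge> 1"
      unfolding q_def
      by (intro eventually_conj eventually_box_size \<open>P \<ge> 2\<close> eventually_ge_at_top)
    then show ?thesis
    proof (rule eventually_mono)
      fix x :: real
      assume "(\<exists>L\<ge>1. real P ^ L \<le> x / 2 \<and> ln x \<le> q * real L) \<and> x \<ge> x0 \<and> x \<ge> 1"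
      then obtain L where L: "L \<ge> 1" "real P ^ L \<le> x / 2" "ln x \<le> q * real L" and x: "x \<ge> x0" "x \<ge> 1"
        by blast
      have h: "eta x > 0" "C1 * x / eta x \<le> real (count_upto A x)"
        "real (count_upto A x) \<le> C2 * x / eta x"
        "C3 * real (count_upto A x) \<le> real (count_upto A (x / 2))"
        "\<And>h. h \<ge> 1 \<Longrightarrow> real (pair_count A x h)
            \<le> C4 * (real h / real (totient h)) * (x / (eta x)\<^sup>2)"
        using hyp x(1) unfolding density_hyps_def by blast+
      have "ln x \<ge> 0" and "x > 0" using x(2) by simp_all
      from K L(1) have KL: "(\<Sum>u\<in>exponent_box d L. \<Sum>v\<in>exponent_box d L.
             gap_totient_quotient (beta d b u) (beta d b v))
          \<le> K * real L ^ (2 * d)" by blast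
      show "c2 * x * (ln x ^ k / (ln x ^ k + eta x))
          \<le> real (card {n :: nat. 1 \<le> n \<and> real n \<le> x \<and>
                            c1 * (ln x ^ d / eta x) \<le> real (rep_count d b A n)})"
        unfolding c1_def c2_def
        by (rule many_popular_values[where b = b, OF \<open>d \<ge> 1\<close> b I assms(3-6) \<open>x > 0\<close> h(1) \<open>ln x \<ge> 0\<close>
              \<open>q \<ge> 1\<close> \<open>K > 0\<close> KL L(1) L(2)[unfolded P_def] L(3) h(2-5)])
    qed
  qed
  show ?thesis
  proof (intro exI conjI allI impI)
    show "c1 > 0" "c2 > 0" by fact+
  qed (rule main[unfolded k_def])
qed

end
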